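(* There is an embedding (injective semigroup homomorphism) $$\psi:\operatorname{Reg}(\mathcal M_{mn}^J)\to\operatorname{Reg}(\mathcal C_m(r))\times\operatorname{Reg}(\mathcal R_n(r)):\ X\mapsto(\psi_1(X),\psi_2(X))=(XJ,JX).$$ As such, $P=\operatorname{Reg}(\mathcal M_{mn}^J)$ is (isomorphic to) a pullback product of $PJ=\operatorname{Reg}(\mathcal C_m(r))$ and $JP=\operatorname{Reg}(\mathcal R_n(r))$. Namely, $$P\cong\operatorname{im}(\psi)=\{(\psi_1(X),\psi_2(X)):X\in P\}=\{(Y,Z)\in PJ\times JP:\phi_1(Y)=\phi_2(Z)\}.$$
   Context: Let $\mathbb F$ be a field, $m,n\geq1$ integers, and $0\leq r\leq\min(m,n)$. $\mathcal M_{kl}$ denotes the set of all $k\times l$ matrices over $\mathbb F$ (a single empty matrix if $k=0$ or $l=0$), and $\mathcal M_k=\mathcal M_{kk}$. Let $J=\begin{bmatrix}I_r&O\\O&O\end{bmatrix}\in\mathcal M_{nm}$ (an $n\times m$ matrix), and let $\mathcal M_{mn}^J$ be the semigroup with underlying set $\mathcal M_{mn}$ and operation $X\star Y=XJY$. For $0\leq l\leq k$, $k\geq1$: $\mathcal C_k(l)$ is the set of all $X\in\mathcal M_k$ whose columns $l+1,\ldots,k$ are zero, and $\mathcal R_k(l)$ is the set of all $X\in\mathcal M_k$ whose rows $l+1,\ldots,k$ are zero; both are semigroups under ordinary matrix multiplication. $\operatorname{Reg}(T)$ denotes the set of regular elements of a semigroup $T$ (those $x$ with $x=xyx$ for some $y\in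 T$); in the present cases these are subsemigroups. $P=\operatorname{Reg}(\mathcal M_{mn}^J)$, $PJ=\{XJ:X\in P\}$, $JP=\{JX:X\in P\}$. The maps $\psi_1:P\to\operatorname{Reg}(\mathcal C_m(r))$ and $\psi_2:P\to\operatorname{Reg}(\mathcal R_n(r))$ are $\psi_1(X)=XJ$, $\psi_2(X)=JX$; the maps $\phi_1:\operatorname{Reg}(\mathcal C_m(r))\to\mathcal M_r$ and $\phi_2:\operatorname{Reg}(\mathcal R_n(r))\to\mathcal M_r$ are $\phi_1\begin{bmatrix}A&O\\C&O\end{bmatrix}=A$ and $\phi_2\begin{bmatrix}A&B\\O&O\end{bmatrix}=A$, where $A\in\mathcal M_r$. (Equivalently, the condition $\phi_1(Y)=\phi_2(Z)$ says $JY=ZJ$.) *)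

theory Defs
  imports "Jordan_Normal_Form.Matrix" "HOL-Algebra.Group"
begin

text \<open>Semigroups are represented by the \<open>monoid\<close> records of HOL-Algebra, so that its notions
  \<open>hom\<close>, \<open>mon\<close>, \<open>iso\<close>, \<open>is_iso\<close> and \<open>DirProd\<close> apply; these depend only on the fields
  \<open>carrier\<close> and \<open>mult\<close>. The field \<open>one\<close> carries no meaning and is left \<open>undefined\<close>.\<close>

definition is_semigroup :: "('a, 'b) monoid_scheme \<Rightarrow> bool" where
  "is_semigroup S \<longleftrightarrow>
     (\<forall>x\<in>carrier S. \<forall>y\<in>carrier S. x \<otimes>\<^bsub>S\<^esub> y \<in> carrier S) \<and>
     (\<forall>x\<in>carrier S. \<forall>y\<in>carrier S. \<forall>z\<in>carrier S.
        (x \<otimes>\<^bsub>S\<^esub> y) \<otimes>\<^bsub>S\<^esub> z = x \<otimes>\<^bsub>S\<^esub> (y \<otimes>\<^bsub>S\<^esub> z))"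

definition Reg :: "('a, 'b) monoid_scheme \<Rightarrow> 'a set" where
  "Reg S = {x \<in> carrier S. \<exists>y\<in>carrier S. x = x \<otimes>\<^bsub>S\<^esub> y \<otimes>\<^bsub>S\<^esub> x}"

definition sub_semigroup :: "'a monoid \<Rightarrow> 'a set \<Rightarrow> 'a monoid" where
  "sub_semigroup S A = S\<lparr>carrier := A\<rparr>"

definition pullback_product ::
  "'a monoid \<Rightarrow> 'b monoid \<Rightarrow> ('a \<Rightarrow> 'c) \<Rightarrow> ('b \<Rightarrow> 'c) \<Rightarrow> ('a \<times> 'b) monoid" where
  "pullback_product S T f g =
     sub_semigroup (S \<times>\<times> T) {(s, t) \<in> carrier S \<times> carrier T. f s = g t}"

definition mat_semigroup :: "nat \<Rightarrow> 'a::field mat monoid" where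
  "mat_semigroup k = \<lparr>carrier = carrier_mat k k, mult = (*), one = undefined\<rparr>"

definition sandwich_semigroup :: "nat \<Rightarrow> nat \<Rightarrow> 'a::field mat \<Rightarrow> 'a mat monoid" where
  "sandwich_semigroup m n J =
     \<lparr>carrier = carrier_mat m n, mult = (\<lambda>X Y. X * J * Y), one = undefined\<rparr>"

text \<open>The \<open>n \<times> m\<close> matrix \<open>J\<close> of the paper (in this order of dimensions, with \<open>r \<le> min m n\<close>).\<close>

definition J_mat :: "nat \<Rightarrow> nat \<Rightarrow> nat \<Rightarrow> 'a::field mat" where
  "J_mat m n r = four_block_mat (1\<^sub>m r) (0\<^sub>m r (m - r)) (0\<^sub>m (n - r) r) (0\<^sub>m (n - r) (m - r))"

text \<open>Rows and columns are indexed from 0, so columns (rows) \<open>l + 1, \<dots>, k\<close> of the paper are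
  those with index in \<open>{l..<k}\<close>.\<close>

definition C_semigroup :: "nat \<Rightarrow> nat \<Rightarrow> 'a::field mat monoid" where
  "C_semigroup k l =
     sub_semigroup (mat_semigroup k) {X \<in> carrier_mat k k. \<forall>j\<in>{l..<k}. col X j = 0\<^sub>v k}"

definition R_semigroup :: "nat \<Rightarrow> nat \<Rightarrow> 'a::field mat monoid" where
  "R_semigroup k l =
     sub_semigroup (mat_semigroup k) {X \<in> carrier_mat k k. \<forall>i\<in>{l..<k}. row X i = 0\<^sub>v k}"

definition psi1 :: "'a::field mat \<Rightarrow> 'a mat \<Rightarrow> 'a mat" where
  "psi1 J X = X * J"

definition psi2 :: "'a::field mat \<Rightarrow> 'a mat \<Rightarrow> 'a mat" where
  "psi2 J X = J * X"

definition psi :: "'a::field mat \<Rightarrow> 'a mat \<Rightarrow> 'a mat \<times> 'a mat" where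
  "psi J X = (psi1 J X, psi2 J X)"

text \<open>Both maps return the upper left \<open>r \<times> r\<close> block; they differ in their intended domains,
  as the two lemmas below record.\<close>

definition phi1 :: "nat \<Rightarrow> 'a::field mat \<Rightarrow> 'a mat" where
  "phi1 r Y = (case split_block Y r r of (A, _, _, _) \<Rightarrow> A)"

definition phi2 :: "nat \<Rightarrow> 'a::field mat \<Rightarrow> 'a mat" where
  "phi2 r Z = (case split_block Z r r of (A, _, _, _) \<Rightarrow> A)"

lemma phi1_four_block_mat:
  assumes "A \<in> carrier_mat r r" and "C \<in> carrier_mat s r"
  shows "phi1 r (four_block_mat A (0\<^sub>m r s) C (0\<^sub>m s s)) = A"
  using assms by (auto simp: phi1_def split_block_def Let_def intro!: eq_matI)

lemma phi2_four_block_mat: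
  assumes "A \<in> carrier_mat r r" and "B \<in> carrier_mat r s"
  shows "phi2 r (four_block_mat A B (0\<^sub>m s r) (0\<^sub>m s s)) = A"
  using assms by (auto simp: phi2_def split_block_def Let_def intro!: eq_matI)

end

theory Submission
  imports Defs
begin

text \<open>Every matrix over a field has an inner inverse. Hence the regular elements of
  \<open>M_mn^J\<close> are closed under \<open>X \<star> Y = X J Y\<close>: if \<open>X = X J V J X\<close>,
  \<open>Y = Y J W J Y\<close> and \<open>T\<close> is an inner inverse of \<open>J X J Y J\<close>, then
  \<open>(X J Y) J T J (X J Y) = X J Y\<close>. A regular \<open>X = X J V J X\<close> is determined by
  \<open>X J\<close> and \<open>J X\<close>; conversely, if \<open>J X J = J X' J\<close>, then \<open>X J V J X'\<close>
  is a regular preimage of \<open>(X J, J X')\<close>.\<close>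

section \<open>Associativity, entries and zero rows or columns of matrices\<close>

text \<open>The hypotheses on dimensions introduce no extra variables, so the simplifier can use
  this as a rewrite rule; right-nested products are the normal form throughout.\<close>

lemma assoc_mult_mat_dim:
  fixes A B C :: "'a::semiring_0 mat"
  assumes "dim_col A = dim_row B" "dim_col B = dim_row C"
  shows "A * B * C = A * (B * C)"
  using assms by (intro assoc_mult_mat[of A "dim_row A" "dim_row B" B "dim_row C" C "dim_col C"]) auto

lemma mult_in_carrier_mat_iff [simp]:
  "A * B \<in> carrier_mat m n \<longleftrightarrow> dim_row A = m \<and> dim_col B = n"
  by (metis carrier_matD carrier_matI index_mult_mat(2,3))

lemma index_mult_mat_sum:
  assumes "A \<in> carrier_mat m k" "B \<in> carrier_mat k n" "i < m" "j < n"
  shows "(A * B) $$ (i, j) = (\<Sum>h<k. A $$ (i, h) * B $$ (h, j))"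
  using assms by (auto simp: scalar_prod_def lessThan_atLeast0 intro!: sum.cong)

lemma row_eq_zero_iff:
  assumes "A \<in> carrier_mat m n" "i < m"
  shows "row A i = 0\<^sub>v n \<longleftrightarrow> (\<forall>j<n. A $$ (i, j) = 0)"
proof
  assume "row A i = 0\<^sub>v n"
  then have "row A i $ j = 0" if "j < n" for j
    using that by simp
  then show "\<forall>j<n. A $$ (i, j) = 0"
    using assms by auto
qed (use assms in \<open>auto intro!: eq_vecI\<close>)

lemma col_eq_zero_iff:
  assumes "A \<in> carrier_mat m n" "j < n"
  shows "col A j = 0\<^sub>v m \<longleftrightarrow> (\<forall>i<m. A $$ (i, j) = 0)"
proof
  assume "col A j = 0\<^sub>v m"
  then have "col A j $ i = 0" if "i < m" for i
    using that by simp
  then show "\<forall>i<m. A $$ (i, j) = 0"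
    using assms by auto
qed (use assms in \<open>auto intro!: eq_vecI\<close>)

section \<open>Inner inverses of matrices\<close>

text \<open>McCoy's lemma on von Neumann regular elements, for rectangular matrices.\<close>

lemma inner_inverse_step:
  fixes A X Y :: "'a::ring_1 mat"
  assumes A: "A \<in> carrier_mat m n" and X: "X \<in> carrier_mat n m" and Y: "Y \<in> carrier_mat n m"
    and eq: "(A - A * X * A) * Y * (A - A * X * A) = A - A * X * A"
  shows "\<exists>E\<in>carrier_mat n m. A * E * A = A"
proof
  \<comment> \<open>Both \<open>A * ?L\<close> and \<open>?R * A\<close> equal
    \<open>A - A * X * A\<close>, so enclosing the correction \<open>?L * Y * ?R\<close> in two
    copies of \<open>A\<close> gives exactly the left side of \<open>eq\<close>.\<close>
  let ?L = "1\<^sub>m n - X * A" and ?R = "1\<^sub>m m - A * X"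
  have L: "A * ?L = A - A * X * A"
    using A X by (subst mult_minus_distrib_mat[of _ m n _ n]) (auto simp: assoc_mult_mat_dim)
  have R: "?R * A = A - A * X * A"
    using A X by (subst minus_mult_distrib_mat[of _ m m _ _ n]) auto
  have "A * (X + ?L * Y * ?R) * A = A * X * A + A * (?L * Y * ?R) * A"
    using A X Y
    by (subst mult_add_distrib_mat[of _ m n _ m], auto, subst add_mult_distrib_mat[of _ m m _ _ n], auto)
  also have "A * (?L * Y * ?R) * A = (A * ?L) * Y * (?R * A)"
    using A X Y by (simp add: assoc_mult_mat_dim)
  also have "\<dots> = A - A * X * A"
    by (simp add: L R eq)
  also have "A * X * A + (A - A * X * A) = A"
    using A X by (intro eq_matI) auto
  finally show "A * (X + ?L * Y * ?R) * A = A" .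
  show "X + ?L * Y * ?R \<in> carrier_mat n m"
    using A X Y by auto
qed

text \<open>Subtracting the rank one matrix \<open>a\<^sub>i\<^sub>j\<^sup>-\<^sup>1 A e\<^sub>j e\<^sub>i\<^sup>T A\<close> clears row \<open>i\<close> and keeps the zero
  rows, so the number of nonzero rows drops.\<close>

lemma exists_inner_inverse:
  fixes A :: "'a::field mat"
  assumes "A \<in> carrier_mat m n"
  shows "\<exists>E\<in>carrier_mat n m. A * E * A = A"
  using assms
proof (induction "card {k. k < m \<and> row A k \<noteq> 0\<^sub>v n}" arbitrary: A rule: less_induct)
  case less
  note A = \<open>A \<in> carrier_mat m n\<close>
  show ?case
  proof (cases "A = 0\<^sub>m m n")
    case True
    then show ?thesis
      by (intro bexI[of _ "0\<^sub>m n m"]) auto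
  next
    case False
    then obtain i j where ij: "i < m" "j < n" "A $$ (i, j) \<noteq> 0"
      using A by (metis carrier_matD eq_matI index_zero_mat)
    \<comment> \<open>The matrix unit at position (j, i), scaled by the inverse of the pivot. Thus
      \<open>A * X * A\<close> is column j of \<open>A\<close> times row i of \<open>A\<close>,
      divided by the pivot.\<close>
    define X where "X = mat n m (\<lambda>(k, l). if k = j \<and> l = i then inverse (A $$ (i, j)) else 0)"
    have X: "X \<in> carrier_mat n m"
      by (simp add: X_def)
    have AX: "(A * X) $$ (k, l) = (if l = i then A $$ (k, j) * inverse (A $$ (i, j)) else 0)"
      if "k < m" "l < m" for k l
    proof -
      have "(A * X) $$ (k, l) = (\<Sum>h<n. A $$ (k, h) * X $$ (h, l))"
        using A X that by (rule index_mult_mat_sum)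
      also have "\<dots> = (\<Sum>h<n. if h = j then A $$ (k, j) * (if l = i then inverse (A $$ (i, j)) else 0) else 0)"
        using that by (intro sum.cong) (auto simp: X_def)
      finally show ?thesis
        using ij by simp
    qed
    have AXA: "(A * X * A) $$ (k, l) = A $$ (k, j) * inverse (A $$ (i, j)) * A $$ (i, l)"
      if "k < m" "l < n" for k l
    proof -
      have "(A * X * A) $$ (k, l) = (\<Sum>h<m. (A * X) $$ (k, h) * A $$ (h, l))"
        by (rule index_mult_mat_sum[OF _ A that]) (use A X in auto)
      also have "\<dots> = (\<Sum>h<m. if h = i then A $$ (k, j) * inverse (A $$ (i, j)) * A $$ (h, l) else 0)"
        using that by (intro sum.cong) (auto simp: AX)
      finally show ?thesis
        using ij by simp
    qed
    let ?B = "A - A * X * A"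
    have B: "?B \<in> carrier_mat m n"
      using A X by auto
    have entry: "?B $$ (k, l) = A $$ (k, l) - A $$ (k, j) * inverse (A $$ (i, j)) * A $$ (i, l)"
      if "k < m" "l < n" for k l
      using A X AXA[OF that] that by (simp del: index_mult_mat(1))
    \<comment> \<open>By \<open>entry\<close>, a zero row k of \<open>A\<close> stays zero because
      its entry in column j is zero too, and row i is cleared. Row i of \<open>A\<close> itself
      contains the pivot, so the inclusion is strict.\<close>
    have "{k. k < m \<and> row ?B k \<noteq> 0\<^sub>v n} \<subset> {k. k < m \<and> row A k \<noteq> 0\<^sub>v n}"
    proof (rule psubsetI)
      show "{k. k < m \<and> row ?B k \<noteq> 0\<^sub>v n} \<subseteq> {k. k < m \<and> row A k \<noteq> 0\<^sub>v n}"
        using ij by (auto simp: row_eq_zero_iff[OF A] row_eq_zero_iff[OF B] entry simp del: index_minus_mat)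
      have "i \<in> {k. k < m \<and> row A k \<noteq> 0\<^sub>v n}" "i \<notin> {k. k < m \<and> row ?B k \<noteq> 0\<^sub>v n}"
        using ij by (auto simp: row_eq_zero_iff[OF A] row_eq_zero_iff[OF B] entry simp del: index_minus_mat)
      then show "{k. k < m \<and> row ?B k \<noteq> 0\<^sub>v n} \<noteq> {k. k < m \<and> row A k \<noteq> 0\<^sub>v n}"
        by blast
    qed
    then have "card {k. k < m \<and> row ?B k \<noteq> 0\<^sub>v n} < card {k. k < m \<and> row A k \<noteq> 0\<^sub>v n}"
      by (intro psubset_card_mono) auto
    from less.hyps[OF this B] obtain Y where "Y \<in> carrier_mat n m" "?B * Y * ?B = ?B"
      by blast
    then show ?thesis
      using inner_inverse_step[OF A X] by blast
  qed
qed

section \<open>Regular elements of a sandwich semigroup of matrices\<close>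

lemma carrier_sub_semigroup [simp]: "carrier (sub_semigroup S A) = A"
  by (simp add: sub_semigroup_def)

lemma mult_sub_semigroup [simp]: "x \<otimes>\<^bsub>sub_semigroup S A\<^esub> y = x \<otimes>\<^bsub>S\<^esub> y"
  by (simp add: sub_semigroup_def)

lemma sandwich_semigroup_simps [simp]:
  "carrier (sandwich_semigroup m n J) = carrier_mat m n"
  "X \<otimes>\<^bsub>sandwich_semigroup m n J\<^esub> Y = X * J * Y"
  by (simp_all add: sandwich_semigroup_def)

lemma mat_semigroup_simps [simp]:
  "carrier (mat_semigroup k) = carrier_mat k k"
  "X \<otimes>\<^bsub>mat_semigroup k\<^esub> Y = X * Y"
  by (simp_all add: mat_semigroup_def)

lemma mult_C_semigroup [simp]: "X \<otimes>\<^bsub>C_semigroup k l\<^esub> Y = X * Y"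
  by (simp add: C_semigroup_def)

lemma mult_R_semigroup [simp]: "X \<otimes>\<^bsub>R_semigroup k l\<^esub> Y = X * Y"
  by (simp add: R_semigroup_def)

text \<open>The witness equation is delivered right-nested, so that it matches terms normalized by
  \<open>assoc_mult_mat_dim\<close>.\<close>

lemma Reg_sandwichE:
  assumes "X \<in> Reg (sandwich_semigroup m n J)" and J: "J \<in> carrier_mat n m"
  obtains V where "X \<in> carrier_mat m n" "V \<in> carrier_mat m n" "X * (J * (V * (J * X))) = X"
proof -
  from assms(1) obtain V where XV: "X \<in> carrier_mat m n" "V \<in> carrier_mat m n"
    and eq: "X = X * J * V * J * X"
    by (auto simp: Reg_def)
  have "X * J * V * J * X = X * (J * (V * (J * X)))"
    using XV J by (simp add: assoc_mult_mat_dim)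
  with XV eq that show thesis
    by metis
qed

lemma Reg_sandwichI:
  assumes "X \<in> carrier_mat m n" "V \<in> carrier_mat m n" "J \<in> carrier_mat n m"
    and "X * (J * (V * (J * X))) = X"
  shows "X \<in> Reg (sandwich_semigroup m n J)"
  using assms by (auto simp: Reg_def assoc_mult_mat_dim intro!: bexI[of _ V])

lemma Reg_sandwich_carrier:
  "X \<in> Reg (sandwich_semigroup m n J) \<Longrightarrow> X \<in> carrier_mat m n"
  by (simp add: Reg_def)

lemma Reg_sandwich_mult_closed:
  fixes J :: "'a::field mat"
  assumes J: "J \<in> carrier_mat n m"
    and "X \<in> Reg (sandwich_semigroup m n J)" "Y \<in> Reg (sandwich_semigroup m n J)"
  shows "X * J * Y \<in> Reg (sandwich_semigroup m n J)"
proof -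
  from assms obtain V W where X: "X \<in> carrier_mat m n" and V: "V \<in> carrier_mat m n"
    and XV: "X * (J * (V * (J * X))) = X"
    and Y: "Y \<in> carrier_mat m n" and W: "W \<in> carrier_mat m n"
    and YW: "Y * (J * (W * (J * Y))) = Y"
    by (metis Reg_sandwichE)
  define N where "N = J * X * J * Y * J"
  have N: "N \<in> carrier_mat n m"
    using J X Y by (simp add: N_def)
  then obtain T where T: "T \<in> carrier_mat m n" and TN: "N * T * N = N"
    using exists_inner_inverse by blast
  \<comment> \<open>Expanding \<open>X\<close> and \<open>Y\<close> by their regularity equations
    exposes the factor \<open>N\<close> between a multiplier from \<open>X\<close> and one from
    \<open>Y\<close>.\<close>
  have Z: "X * J * Y = (X * J * V) * N * (W * J * Y)"
  proof -
    have "X * J * Y = (X * (J * (V * (J * X)))) * J * (Y * (J * (W * (J * Y))))"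
      by (simp only: XV YW)
    also have "\<dots> = (X * J * V) * N * (W * J * Y)"
      using J X Y V W by (simp add: N_def assoc_mult_mat_dim)
    finally show ?thesis .
  qed
  \<comment> \<open>An outer \<open>J\<close> already supplies one end of \<open>N\<close>, so only
    the opposite factor has to be expanded, here and in \<open>JZ\<close>. Between
    \<open>X * J * Y * J\<close> and \<open>J * (X * J * Y)\<close> the matrix \<open>T\<close> then
    meets \<open>N\<close> on both sides.\<close>
  have ZJ: "X * J * Y * J = (X * J * V) * N"
  proof -
    have "X * J * Y * J = (X * (J * (V * (J * X)))) * J * Y * J"
      by (simp only: XV)
    also have "\<dots> = (X * J * V) * N"
      using J X Y V W by (simp add: N_def assoc_mult_mat_dim)
    finally show ?thesis .
  qed
  have JZ: "J * (X * J * Y) = N * (W * J * Y)"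
  proof -
    have "J * (X * J * Y) = J * (X * J * (Y * (J * (W * (J * Y)))))"
      by (simp only: YW)
    also have "\<dots> = N * (W * J * Y)"
      using J X Y V W by (simp add: N_def assoc_mult_mat_dim)
    finally show ?thesis .
  qed
  have "X * J * Y * (J * (T * (J * (X * J * Y)))) = (X * J * Y * J) * T * (J * (X * J * Y))"
    using J X Y T by (simp add: assoc_mult_mat_dim)
  also have "\<dots> = (X * J * V) * (N * T * N) * (W * J * Y)"
    unfolding ZJ JZ using J X Y V W N T by (simp add: assoc_mult_mat_dim)
  also have "\<dots> = X * J * Y"
    by (simp only: TN Z)
  finally show ?thesis
    using J X Y T by (intro Reg_sandwichI[of _ m n T]) auto
qed

text \<open>In X = X J V J X replace the left X J by Y J and expand that Y with its own witness W.
  Turning the J Y so exposed into J X lets V cancel; what is left, Y J W J X, equals Y J W J Y =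
  Y.\<close>

lemma Reg_sandwich_eqI:
  assumes J: "J \<in> carrier_mat n m"
    and "X \<in> Reg (sandwich_semigroup m n J)" "Y \<in> Reg (sandwich_semigroup m n J)"
    and XJ: "X * J = Y * J" and JX: "J * X = J * Y"
  shows "X = Y"
proof -
  from assms obtain V W where X: "X \<in> carrier_mat m n" and V: "V \<in> carrier_mat m n"
    and XV: "X * (J * (V * (J * X))) = X"
    and Y: "Y \<in> carrier_mat m n" and W: "W \<in> carrier_mat m n"
    and YW: "Y * (J * (W * (J * Y))) = Y"
    by (metis Reg_sandwichE)
  have "X = (X * J) * (V * (J * X))"
    using J X V XV by (simp add: assoc_mult_mat_dim)
  also have "\<dots> = (Y * (J * (W * (J * Y)))) * J * (V * (J * X))"
    by (simp only: XJ YW)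
  also have "\<dots> = Y * (J * (W * ((J * Y) * (J * (V * (J * X))))))"
    using J X Y V W by (simp add: assoc_mult_mat_dim)
  also have "\<dots> = Y * (J * (W * (J * (X * (J * (V * (J * X)))))))"
    using J X Y V W by (simp add: assoc_mult_mat_dim flip: JX)
  also have "\<dots> = Y * (J * (W * (J * Y)))"
    by (simp only: XV) (simp only: JX)
  also have "\<dots> = Y"
    by (rule YW)
  finally show ?thesis .
qed

text \<open>Supplies surjectivity onto the pullback: the left part of Z comes from X, its right part
  from Y, and the witness V of X joins them.\<close>

lemma Reg_sandwich_glue:
  assumes J: "J \<in> carrier_mat n m"
    and "X \<in> Reg (sandwich_semigroup m n J)" "Y \<in> Reg (sandwich_semigroup m n J)"
    and JXJ: "J * (X * J) = J * Y * J"
  obtains Z where "Z \<in> Reg (sandwich_semigroup m n J)" "Z * J = X * J" "J * Z = J * Y"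
proof -
  from assms obtain V W where X: "X \<in> carrier_mat m n" and V: "V \<in> carrier_mat m n"
    and XV: "X * (J * (V * (J * X))) = X"
    and Y: "Y \<in> carrier_mat m n" and W: "W \<in> carrier_mat m n"
    and YW: "Y * (J * (W * (J * Y))) = Y"
    by (metis Reg_sandwichE)
  define Z where "Z = X * J * V * J * Y"
  have Z: "Z \<in> carrier_mat m n"
    using J X V Y by (simp add: Z_def)
  have "Z * J = X * (J * (V * (J * Y * J)))"
    using J X V Y by (simp add: Z_def assoc_mult_mat_dim)
  also have "\<dots> = (X * (J * (V * (J * X)))) * J"
    using J X V Y by (simp add: assoc_mult_mat_dim flip: JXJ)
  finally have ZJ: "Z * J = X * J"
    by (simp only: XV)
  \<comment> \<open>Here V cannot cancel at once. Expanding Y with W exposes J Y J, which becomes J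
    X J; then V cancels against X, and J X J is turned back into J Y J.\<close>
  have "J * Z = J * (X * J * V * J * (Y * (J * (W * (J * Y)))))"
    by (simp only: Z_def YW)
  also have "\<dots> = J * (X * (J * (V * ((J * Y * J) * (W * (J * Y))))))"
    using J X V Y W by (simp add: assoc_mult_mat_dim)
  also have "\<dots> = J * ((X * (J * (V * (J * X)))) * J) * (W * (J * Y))"
    using J X V Y W by (simp add: assoc_mult_mat_dim flip: JXJ)
  also have "\<dots> = J * (Y * (J * (W * (J * Y))))"
    unfolding XV JXJ using J Y W by (simp add: assoc_mult_mat_dim)
  finally have JZ: "J * Z = J * Y"
    by (simp only: YW)
  \<comment> \<open>The same V witnesses regularity of Z, since this product sees Z only through Z J
    = X J and J Z = J Y.\<close>
  have "Z * (J * (V * (J * Z))) = (Z * J) * (V * (J * Z))"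
    using J V Z by (simp add: assoc_mult_mat_dim)
  also have "\<dots> = X * J * (V * (J * Y))"
    by (simp only: ZJ JZ)
  also have "\<dots> = Z"
    unfolding Z_def using J X V Y by (simp add: assoc_mult_mat_dim)
  finally have "Z \<in> Reg (sandwich_semigroup m n J)"
    using Z V J by (intro Reg_sandwichI)
  then show thesis
    using ZJ JZ by (rule that)
qed

section \<open>The matrix \<open>J\<close> and the upper left block\<close>

lemma J_mat_carrier: "r \<le> min m n \<Longrightarrow> J_mat m n r \<in> carrier_mat n m"
  using four_block_carrier_mat[of "1\<^sub>m r" r r "0\<^sub>m (n - r) (m - r)" "n - r" "m - r"]
  by (simp add: J_mat_def)

lemma dim_J_mat [simp]:
  assumes "r \<le> min m n"
  shows "dim_row (J_mat m n r) = n" "dim_col (J_mat m n r) = m"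
  using J_mat_carrier[OF assms] by auto

lemma index_J_mat:
  "r \<le> min m n \<Longrightarrow> i < n \<Longrightarrow> j < m \<Longrightarrow>
    J_mat m n r $$ (i, j) = (if i = j \<and> i < r then 1 else 0)"
  by (auto simp: J_mat_def)

lemma index_mult_J_mat:
  assumes "r \<le> min m n" "X \<in> carrier_mat k n" "i < k" "j < m"
  shows "(X * J_mat m n r) $$ (i, j) = (if j < r then X $$ (i, j) else 0)"
proof -
  have "(X * J_mat m n r) $$ (i, j) = (\<Sum>h<n. X $$ (i, h) * J_mat m n r $$ (h, j))"
    using assms(2) J_mat_carrier[OF assms(1)] assms(3,4) by (rule index_mult_mat_sum)
  also have "\<dots> = (\<Sum>h<n. if h = j then if j < r then X $$ (i, j) else 0 else 0)"
    using assms by (intro sum.cong) (auto simp: index_J_mat)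
  finally show ?thesis
    using assms by auto
qed

lemma index_J_mat_mult:
  assumes "r \<le> min m n" "X \<in> carrier_mat m k" "i < n" "j < k"
  shows "(J_mat m n r * X) $$ (i, j) = (if i < r then X $$ (i, j) else 0)"
proof -
  have "(J_mat m n r * X) $$ (i, j) = (\<Sum>h<m. J_mat m n r $$ (i, h) * X $$ (h, j))"
    using J_mat_carrier[OF assms(1)] assms(2-4) by (rule index_mult_mat_sum)
  also have "\<dots> = (\<Sum>h<m. if h = i then if i < r then X $$ (i, j) else 0 else 0)"
    using assms by (intro sum.cong) (auto simp: index_J_mat)
  finally show ?thesis
    using assms by auto
qed

section \<open>The semigroups of matrices with zero columns or rows, and their regular
  elements\<close>

lemma carrier_C_semigroup:
  "carrier (C_semigroup k l) = {X \<in> carrier_mat k k. \<forall>i<k. \<forall>j\<in>{l..<k}. X $$ (i, j) = 0}"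
  by (auto simp: C_semigroup_def col_eq_zero_iff)

lemma carrier_R_semigroup:
  "carrier (R_semigroup k l) = {X \<in> carrier_mat k k. \<forall>i\<in>{l..<k}. \<forall>j<k. X $$ (i, j) = 0}"
  by (auto simp: R_semigroup_def row_eq_zero_iff)

lemma mult_J_mat_in_C_semigroup:
  "r \<le> min m n \<Longrightarrow> X \<in> carrier_mat m n \<Longrightarrow> X * J_mat m n r \<in> carrier (C_semigroup m r)"
  by (auto simp: carrier_C_semigroup index_mult_J_mat simp del: index_mult_mat(1))

lemma J_mat_mult_in_R_semigroup:
  "r \<le> min m n \<Longrightarrow> X \<in> carrier_mat m n \<Longrightarrow> J_mat m n r * X \<in> carrier (R_semigroup n r)"
  by (auto simp: carrier_R_semigroup index_J_mat_mult simp del: index_mult_mat(1))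

text \<open>\<open>J_mat n m r\<close> is the transpose of \<open>J_mat m n r\<close>. Their product
  here is the diagonal idempotent that keeps the first r columns, a right identity for
  \<open>C_semigroup m r\<close>.\<close>

lemma C_semigroup_mult_J_mat:
  assumes "r \<le> min m n" "Y \<in> carrier (C_semigroup m r)"
  shows "Y * J_mat n m r * J_mat m n r = Y"
proof -
  have r: "r \<le> min n m"
    using assms by simp
  have Y: "Y \<in> carrier_mat m m"
    using assms by (simp add: carrier_C_semigroup)
  have YJ: "Y * J_mat n m r \<in> carrier_mat m n"
    using Y r by simp
  show ?thesis
    using assms Y
    by (intro eq_matI) (auto simp: index_mult_J_mat[OF assms(1) YJ] index_mult_J_mat[OF r Y]
        carrier_C_semigroup simp del: index_mult_mat(1))
qed

text \<open>Dually, the product of the two matrices in the other order is an idempotent that keeps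
  the first r rows.\<close>

lemma R_semigroup_J_mat_mult:
  assumes "r \<le> min m n" "Z \<in> carrier (R_semigroup n r)"
  shows "J_mat m n r * (J_mat n m r * Z) = Z"
proof -
  have r: "r \<le> min n m"
    using assms by simp
  have Z: "Z \<in> carrier_mat n n"
    using assms by (simp add: carrier_R_semigroup)
  have JZ: "J_mat n m r * Z \<in> carrier_mat m n"
    using Z r by simp
  show ?thesis
    using assms Z
    by (intro eq_matI) (auto simp: index_J_mat_mult[OF assms(1) JZ] index_J_mat_mult[OF r Z]
        carrier_R_semigroup simp del: index_mult_mat(1))
qed

text \<open>Multiplication by the transpose \<open>?J'\<close> lifts Y = Y W Y to the element Y J'
  with witness W J', and J' J then cancels by \<open>C_semigroup_mult_J_mat\<close>. Conversely, if
  V witnesses X, then V J witnesses X J and lies in \<open>C_semigroup m r\<close>.\<close>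

lemma Reg_C_semigroup_eq:
  assumes r: "r \<le> min m n"
  shows "Reg (C_semigroup m r) =
    (\<lambda>X. X * J_mat m n r) ` Reg (sandwich_semigroup m n (J_mat m n r :: 'a::field mat))"
    (is "?C = ?f ` ?P")
proof (intro equalityI subsetI)
  let ?J = "J_mat m n r :: 'a mat" and ?J' = "J_mat n m r :: 'a mat"
  have J: "?J \<in> carrier_mat n m" "?J' \<in> carrier_mat m n"
    using r J_mat_carrier[of r m n] J_mat_carrier[of r n m] by auto
  fix Y :: "'a mat"
  {
    assume "Y \<in> ?C"
    then obtain W where YC: "Y \<in> carrier (C_semigroup m r)" and WC: "W \<in> carrier (C_semigroup m r)"
      and eq: "Y = Y * W * Y"
      by (auto simp: Reg_def)
    then have YW: "Y \<in> carrier_mat m m" "W \<in> carrier_mat m m"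
      by (auto simp: carrier_C_semigroup)
    have "Y * ?J' * (?J * (W * ?J' * (?J * (Y * ?J')))) =
        (Y * ?J' * ?J) * (W * ?J' * ?J) * Y * ?J'"
      using J YW by (simp add: assoc_mult_mat_dim)
    also have "\<dots> = Y * ?J'"
      by (simp only: C_semigroup_mult_J_mat[OF r] YC WC flip: eq)
    finally have "Y * ?J' \<in> ?P"
      using J YW by (intro Reg_sandwichI[of _ m n "W * ?J'"]) auto
    then show "Y \<in> ?f ` ?P"
      using C_semigroup_mult_J_mat[OF r YC] by (intro image_eqI[of _ _ "Y * ?J'"]) auto
  next
    assume "Y \<in> ?f ` ?P"
    then obtain X where "X \<in> ?P" and Y: "Y = X * ?J"
      by blast
    then obtain V where X: "X \<in> carrier_mat m n" and V: "V \<in> carrier_mat m n"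
      and XV: "X * (?J * (V * (?J * X))) = X"
      using J by (metis Reg_sandwichE)
    have "Y * (V * ?J) * Y = X * (?J * (V * (?J * X))) * ?J"
      using J X V by (simp add: Y assoc_mult_mat_dim)
    then have "Y = Y * (V * ?J) * Y"
      by (simp only: XV Y)
    then show "Y \<in> ?C"
      using mult_J_mat_in_C_semigroup[OF r] X V Y by (auto simp: Reg_def)
  }
qed

text \<open>The dual argument, multiplying by \<open>?J'\<close> on the left: Z lifts to J' Z, and J
  V witnesses J X.\<close>

lemma Reg_R_semigroup_eq:
  assumes r: "r \<le> min m n"
  shows "Reg (R_semigroup n r) =
    (\<lambda>X. J_mat m n r * X) ` Reg (sandwich_semigroup m n (J_mat m n r :: 'a::field mat))"
    (is "?R = ?f ` ?P")
proof (intro equalityI subsetI)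
  let ?J = "J_mat m n r :: 'a mat" and ?J' = "J_mat n m r :: 'a mat"
  have J: "?J \<in> carrier_mat n m" "?J' \<in> carrier_mat m n"
    using r J_mat_carrier[of r m n] J_mat_carrier[of r n m] by auto
  fix Z :: "'a mat"
  {
    assume "Z \<in> ?R"
    then obtain W where ZR: "Z \<in> carrier (R_semigroup n r)" and WR: "W \<in> carrier (R_semigroup n r)"
      and eq: "Z = Z * W * Z"
      by (auto simp: Reg_def)
    then have ZW: "Z \<in> carrier_mat n n" "W \<in> carrier_mat n n"
      by (auto simp: carrier_R_semigroup)
    have "?J' * Z * (?J * (?J' * W * (?J * (?J' * Z)))) =
        ?J' * (Z * (?J * (?J' * W)) * (?J * (?J' * Z)))"
      using J ZW by (simp add: assoc_mult_mat_dim)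
    also have "\<dots> = ?J' * Z"
      by (simp only: R_semigroup_J_mat_mult[OF r] ZR WR flip: eq)
    finally have "?J' * Z \<in> ?P"
      using J ZW by (intro Reg_sandwichI[of _ m n "?J' * W"]) auto
    then show "Z \<in> ?f ` ?P"
      using R_semigroup_J_mat_mult[OF r ZR] by (intro image_eqI[of _ _ "?J' * Z"]) auto
  next
    assume "Z \<in> ?f ` ?P"
    then obtain X where "X \<in> ?P" and Z: "Z = ?J * X"
      by blast
    then obtain V where X: "X \<in> carrier_mat m n" and V: "V \<in> carrier_mat m n"
      and XV: "X * (?J * (V * (?J * X))) = X"
      using J by (metis Reg_sandwichE)
    have "Z * (?J * V) * Z = ?J * (X * (?J * (V * (?J * X))))"
      using J X V by (simp add: Z assoc_mult_mat_dim)
    then have "Z = Z * (?J * V) * Z"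
      by (simp only: XV Z)
    then show "Z \<in> ?R"
      using J_mat_mult_in_R_semigroup[OF r] X V Z by (auto simp: Reg_def)
  }
qed

section \<open>The upper left block as a homomorphism, and the pullback condition\<close>

lemma phi1_eq: "phi1 r Y = mat r r (\<lambda>ij. Y $$ ij)"
  by (auto simp: phi1_def split_block_def Let_def)

lemma phi2_eq: "phi2 r Z = mat r r (\<lambda>ij. Z $$ ij)"
  by (auto simp: phi2_def split_block_def Let_def)

text \<open>Either alternative of \<open>zero\<close> kills the summands with inner index at least
  r. The first one holds in \<open>C_semigroup k r\<close>, the second in
  \<open>R_semigroup k r\<close>, so one lemma serves \<open>phi1\<close> and
  \<open>phi2\<close>.\<close>

lemma upper_left_block_mult:
  fixes Y Z :: "'a::semiring_0 mat"
  assumes "r \<le> k" "Y \<in> carrier_mat k k" "Z \<in> carrier_mat k k"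
    and zero: "(\<forall>i<r. \<forall>h\<in>{r..<k}. Y $$ (i, h) = 0) \<or> (\<forall>h\<in>{r..<k}. \<forall>j<r. Z $$ (h, j) = 0)"
  shows "mat r r (\<lambda>ij. (Y * Z) $$ ij) = mat r r (\<lambda>ij. Y $$ ij) * mat r r (\<lambda>ij. Z $$ ij)"
proof (rule eq_matI)
  fix i j
  assume "i < dim_row (mat r r (\<lambda>ij. Y $$ ij) * mat r r (\<lambda>ij. Z $$ ij))"
    and "j < dim_col (mat r r (\<lambda>ij. Y $$ ij) * mat r r (\<lambda>ij. Z $$ ij))"
  then have ij: "i < r" "j < r"
    by auto
  have "(Y * Z) $$ (i, j) = (\<Sum>h<k. Y $$ (i, h) * Z $$ (h, j))"
    using assms ij by (intro index_mult_mat_sum[of _ k _ _ k]) auto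
  also have "\<dots> = (\<Sum>h<r. Y $$ (i, h) * Z $$ (h, j))"
    using assms(1) zero ij by (intro sum.mono_neutral_right) auto
  also have "\<dots> = (mat r r (\<lambda>ij. Y $$ ij) * mat r r (\<lambda>ij. Z $$ ij)) $$ (i, j)"
    using ij by (subst index_mult_mat_sum[of _ r r _ r]) auto
  finally show "mat r r (\<lambda>ij. (Y * Z) $$ ij) $$ (i, j) =
      (mat r r (\<lambda>ij. Y $$ ij) * mat r r (\<lambda>ij. Z $$ ij)) $$ (i, j)"
    using ij by simp
qed simp_all

text \<open>Both J Y and Z J vanish outside the upper left r by r block: J clears the remaining rows
  of Y and columns of Z, and the other entries outside are zero by membership. Inside the block they
  agree with Y and Z.\<close>

lemma phi1_eq_phi2_iff:
  assumes r: "r \<le> min m n" and Y: "Y \<in> carrier (C_semigroup m r)"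
    and Z: "Z \<in> carrier (R_semigroup n r)"
  shows "phi1 r Y = phi2 r Z \<longleftrightarrow> J_mat m n r * Y = Z * J_mat m n r"
proof -
  have YZ: "Y \<in> carrier_mat m m" "Z \<in> carrier_mat n n"
    using Y Z by (auto simp: carrier_C_semigroup carrier_R_semigroup)
  have "J_mat m n r * Y = Z * J_mat m n r \<longleftrightarrow>
      (\<forall>i<n. \<forall>j<m. (if i < r then Y $$ (i, j) else 0) = (if j < r then Z $$ (i, j) else 0))"
    using YZ r
    by (auto simp: mat_eq_iff index_J_mat_mult[OF r YZ(1)] index_mult_J_mat[OF r YZ(2)]
        simp del: index_mult_mat(1))
  also have "\<dots> \<longleftrightarrow> (\<forall>i<r. \<forall>j<r. Y $$ (i, j) = Z $$ (i, j))"
    (is "?L \<longleftrightarrow> ?S")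
  proof
    assume ?L
    then show ?S
      using r by (metis min.boundedE order_less_le_trans)
  next
    assume ?S
    then show ?L
      using r Y Z by (auto simp: carrier_C_semigroup carrier_R_semigroup)
  qed
  also have "\<dots> \<longleftrightarrow> phi1 r Y = phi2 r Z"
    by (auto simp: phi1_eq phi2_eq mat_eq_iff)
  finally show ?thesis
    by simp
qed

section \<open>The pullback decomposition\<close>

theorem proposition5p8:
  fixes m n r :: nat
    and J :: "'a::field mat"
    and P RegC RegR :: "'a mat monoid"
    and PJ JP :: "'a mat set"
  assumes "m \<ge> 1" and "n \<ge> 1" and "r \<le> min m n"
    and "J = J_mat m n r"
    and "P = sub_semigroup (sandwich_semigroup m n J) (Reg (sandwich_semigroup m n J))"
    and "RegC = sub_semigroup (C_semigroup m r) (Reg (C_semigroup m r))"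
    and "RegR = sub_semigroup (R_semigroup n r) (Reg (R_semigroup n r))"
    and "PJ = {X * J |X. X \<in> carrier P}"
    and "JP = {J * X |X. X \<in> carrier P}"
  shows "is_semigroup P \<and> is_semigroup RegC \<and> is_semigroup RegR \<and>
    psi J \<in> mon P (RegC \<times>\<times> RegR) \<and>
    PJ = carrier RegC \<and> JP = carrier RegR \<and>
    phi1 r \<in> hom RegC (mat_semigroup r) \<and> phi2 r \<in> hom RegR (mat_semigroup r) \<and>
    psi J ` carrier P = {(psi1 J X, psi2 J X) |X. X \<in> carrier P} \<and>
    psi J ` carrier P = {(Y, Z) \<in> PJ \<times> JP. phi1 r Y = phi2 r Z} \<and>
    P \<cong> sub_semigroup (RegC \<times>\<times> RegR) (psi J ` carrier P) \<and>
    P \<cong> pullback_product RegC RegR (phi1 r) (phi2 r)"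
proof -
  note r = \<open>r \<le> min m n\<close>
  define R where "R = Reg (sandwich_semigroup m n J)"
  have J: "J \<in> carrier_mat n m"
    using J_mat_carrier[OF r] assms(4) by simp
  have P: "carrier P = R" "\<And>X Y. X \<otimes>\<^bsub>P\<^esub> Y = X * J * Y"
    using assms by (simp_all add: R_def)
  have C: "carrier RegC = (\<lambda>X. X * J) ` R" "\<And>X Y. X \<otimes>\<^bsub>RegC\<^esub> Y = X * Y"
    using assms Reg_C_semigroup_eq[OF r] by (simp_all add: R_def)
  have D: "carrier RegR = (\<lambda>X. J * X) ` R" "\<And>X Y. X \<otimes>\<^bsub>RegR\<^esub> Y = X * Y"
    using assms Reg_R_semigroup_eq[OF r] by (simp_all add: R_def)
  have R_carrier: "X \<in> carrier_mat m n" if "X \<in> R" for X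
    using that Reg_sandwich_carrier by (auto simp: R_def)
  have R_closed: "X * J * Y \<in> R" if "X \<in> R" "Y \<in> R" for X Y
    using that Reg_sandwich_mult_closed[OF J] by (simp add: R_def)
  have in_C: "X * J \<in> carrier (C_semigroup m r)" if "X \<in> R" for X
    using that mult_J_mat_in_C_semigroup[OF r R_carrier] assms(4) by simp
  have in_R: "J * X \<in> carrier (R_semigroup n r)" if "X \<in> R" for X
    using that J_mat_mult_in_R_semigroup[OF r R_carrier] assms(4) by simp
  \<comment> \<open>These identities make \<open>psi J\<close> multiplicative, and with
    \<open>R_closed\<close> they also close the images of \<open>R\<close> under matrix
    multiplication.\<close>
  have multJ: "(X * J) * (Y * J) = (X * J * Y) * J" and Jmult: "(J * X) * (J * Y) = J * (X * J * Y)"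
    if "X \<in> R" "Y \<in> R" for X Y
    using that[THEN R_carrier] J by (simp_all add: assoc_mult_mat_dim)

  have semiP: "is_semigroup P"
    using R_closed J by (auto simp: is_semigroup_def P assoc_mult_mat_dim dest!: R_carrier)
  have semiC: "is_semigroup RegC"
    using R_closed J by (auto simp: is_semigroup_def C multJ assoc_mult_mat_dim dest!: R_carrier)
  have semiR: "is_semigroup RegR"
    using R_closed J by (auto simp: is_semigroup_def D Jmult assoc_mult_mat_dim dest!: R_carrier)
  have inj: "inj_on (psi J) R"
    using Reg_sandwich_eqI[OF J] by (auto simp: inj_on_def psi_def psi1_def psi2_def R_def)
  have psi_hom: "psi J \<in> hom P (RegC \<times>\<times> RegR)"
    by (auto simp: hom_def P C D psi_def psi1_def psi2_def multJ Jmult)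
  have PJ: "PJ = carrier RegC" and JP: "JP = carrier RegR"
    using assms(8,9) by (auto simp: P C D)
  have phi1_hom: "phi1 r \<in> hom RegC (mat_semigroup r)"
  proof (rule homI)
    fix Y Z assume "Y \<in> carrier RegC" "Z \<in> carrier RegC"
    then have "Y \<in> carrier (C_semigroup m r)" "Z \<in> carrier (C_semigroup m r)"
      using in_C by (auto simp: C)
    then show "phi1 r (Y \<otimes>\<^bsub>RegC\<^esub> Z) = phi1 r Y \<otimes>\<^bsub>mat_semigroup r\<^esub> phi1 r Z"
      using r unfolding C phi1_eq mat_semigroup_simps
      by (intro upper_left_block_mult[of r m]) (auto simp: carrier_C_semigroup)
  qed (simp add: phi1_eq)
  have phi2_hom: "phi2 r \<in> hom RegR (mat_semigroup r)"
  proof (rule homI)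
    fix Y Z assume "Y \<in> carrier RegR" "Z \<in> carrier RegR"
    then have "Y \<in> carrier (R_semigroup n r)" "Z \<in> carrier (R_semigroup n r)"
      using in_R by (auto simp: D)
    then show "phi2 r (Y \<otimes>\<^bsub>RegR\<^esub> Z) = phi2 r Y \<otimes>\<^bsub>mat_semigroup r\<^esub> phi2 r Z"
      using r unfolding D phi2_eq mat_semigroup_simps
      by (intro upper_left_block_mult[of r n]) (auto simp: carrier_R_semigroup)
  qed (simp add: phi2_eq)
  \<comment> \<open>Written with preimages in \<open>R\<close>, the pullback condition becomes
    exactly the hypothesis of \<open>Reg_sandwich_glue\<close>.\<close>
  have phi_iff: "phi1 r (X * J) = phi2 r (J * Y) \<longleftrightarrow> J * (X * J) = J * Y * J"
    if "X \<in> R" "Y \<in> R" for X Y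
    using phi1_eq_phi2_iff[OF r] in_C[OF that(1)] in_R[OF that(2)] assms(4) by simp
  have image: "psi J ` R = {(Y, Z) \<in> carrier RegC \<times> carrier RegR. phi1 r Y = phi2 r Z}"
  proof (intro equalityI subsetI)
    fix p assume "p \<in> psi J ` R"
    then obtain X where X: "X \<in> R" and p: "p = (X * J, J * X)"
      by (auto simp: psi_def psi1_def psi2_def)
    have "J * (X * J) = J * X * J"
      using J R_carrier[OF X] by (simp add: assoc_mult_mat_dim)
    then show "p \<in> {(Y, Z) \<in> carrier RegC \<times> carrier RegR. phi1 r Y = phi2 r Z}"
      using X by (simp add: p C D phi_iff)
  next
    fix p assume "p \<in> {(Y, Z) \<in> carrier RegC \<times> carrier RegR. phi1 r Y = phi2 r Z}"
    then obtain X Y where XY: "X \<in> R" "Y \<in> R" and p: "p = (X * J, J * Y)"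
      and eq: "J * (X * J) = J * Y * J"
      by (auto simp: C D phi_iff)
    then obtain Z where "Z \<in> R" "Z * J = X * J" "J * Z = J * Y"
      unfolding R_def using Reg_sandwich_glue[OF J] by metis
    then show "p \<in> psi J ` R"
      unfolding p by (intro image_eqI[of _ _ Z]) (simp_all add: psi_def psi1_def psi2_def)
  qed
  \<comment> \<open>An injective homomorphism is an isomorphism onto its image; rewriting the image
    by \<open>image\<close> then yields the pullback product.\<close>
  have iso: "P \<cong> sub_semigroup (RegC \<times>\<times> RegR) (psi J ` R)"
    using psi_hom inj by (intro is_isoI[of "psi J"]) (auto simp: iso_def hom_def bij_betw_def P)
  then have "P \<cong> pullback_product RegC RegR (phi1 r) (phi2 r)"
    by (simp add: pullback_product_def image)
  moreover have "psi J \<in> mon P (RegC \<times>\<times> RegR)"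
    using psi_hom inj by (simp add: mon_def P)
  moreover have "psi J ` R = {(psi1 J X, psi2 J X) |X. X \<in> R}"
    by (auto simp: psi_def)
  ultimately show ?thesis
    using semiP semiC semiR phi1_hom phi2_hom image iso unfolding PJ JP P by blast
qed

end
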